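(* Let $\{\{X_s:s\in\omega^{n+1}\}:n\in\omega\}$ be a family such that for every $n\in\omega$, $\{X_s:s\in\omega^{n+1}\}$ is a partition of $\omega$ into infinite sets, and such that $\bigcap_{i\in F}X_{s_i}$ is infinite for every finite $F\subseteq\omega$ and every choice of $s_i\in\omega^{i+1}$, $i\in F$, and let $\mathrm{Fin}'_\omega$ be the ideal on $\omega$ defined from this family as in the context. Then for any ideal $\mathcal{I}$ the following are equivalent: (a) $\mathrm{Fin}'_\omega\sqsubseteq\mathcal{I}$; (b) $\mathrm{Fin}'_\omega\leq_K\mathcal{I}$; (c) $\mathrm{Fin}^{n+1}\sqsubseteq\mathcal{I}$ for all $n\in\omega$; (d) $\mathrm{Fin}^{n+1}\leq_K\mathcal{I}$ for all $n\in\omega$.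
   Context: An ideal on a countably infinite set $X$ is a family of subsets of $X$ closed under subsets and finite unions, not containing $X$ and containing all finite subsets of $X$; write $\mathrm{dom}(\mathcal{I})=X$. $\mathrm{Fin}$ is the ideal of finite subsets of $\omega$. For $n\ge1$ the ideal $\mathrm{Fin}^n$ on $\omega^n$ is defined by $\mathrm{Fin}^1=\mathrm{Fin}$ and: $A\subseteq\omega^{n+1}$ is in $\mathrm{Fin}^{n+1}$ iff $\{i\in\omega:\{x\in\omega^n:(i,x)\in A\}\notin\mathrm{Fin}^n\}$ is finite. For $n\in\omega$, $\mathrm{Fin}^{n+2}(\{X_s:s\in\omega^{n+1}\})$ is the family of all $A\subseteq\omega$ with $\{s\in\omega^{n+1}:A\cap X_s\text{ infinite}\}\in\mathrm{Fin}^{n+1}$; $\mathrm{Fin}'_\omega$ is the ideal on $\omega$ generated by $\bigcup_{n\in\omega}\mathrm{Fin}^{n+2}(\{X_s:s\in\omega^{n+1}\})$ (sets contained in finite unions of members). For ideals $\mathcal{I},\mathcal{J}$: $\mathcal{I}\sqsubseteq\mathcal{J}$ means there is a bijection $f:\mathrm{dom}(\mathcal{J})\to\mathrm{dom}(\mathcal{I})$ with $f^{-1}[A]\in\mathcal{J}$ for all $A\in\mathcal{I}$; $\mathcal{I}\leq_K\mathcal{J}$ (Katětov order) means there is a function (not necessarily a bijection) $f:\mathrm{dom}(\mathcal{J})\to\mathrm{dom}(\mathcal{I})$ with $f^{-1}[A]\in\mathcal{J}$ for all $A\in\mathcal{I}$. *)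

theory Defs
  imports Complex_Main "HOL-Library.Countable_Set" "HOL-Library.FuncSet" "HOL-Library.Disjoint_Sets"
begin

definition ideal_on :: "'a set \<Rightarrow> 'a set set \<Rightarrow> bool" where
  "ideal_on D I \<longleftrightarrow>
     countable D \<and> infinite D \<and>
     I \<subseteq> Pow D \<and>
     (\<forall>A\<in>I. \<forall>B. B \<subseteq> A \<longrightarrow> B \<in> I) \<and>
     (\<forall>A\<in>I. \<forall>B\<in>I. A \<union> B \<in> I) \<and>
     D \<notin> I \<and>
     (\<forall>A. A \<subseteq> D \<and> finite A \<longrightarrow> A \<in> I)"

text \<open>Elements of $\omega^n$ are lists of length $n$; a pair $(i,x)$ in
  $\omega \times \omega^n = \omega^{n+1}$ is the list \<open>i # x\<close>.\<close>

definition seqs :: "nat \<Rightarrow> nat list set" where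
  "seqs n = {s. length s = n}"

text \<open>The ideal $\mathrm{Fin}^n$ on $\omega^n$ for $n \ge 1$, where $\omega^1$ (lists of length one)
  is identified with $\omega$. The value at \<open>0\<close> is a dummy and is never used.\<close>

fun Fin_pow :: "nat \<Rightarrow> nat list set set" where
  "Fin_pow 0 = {{}}"
| "Fin_pow (Suc 0) = {A. A \<subseteq> seqs 1 \<and> finite A}"
| "Fin_pow (Suc (Suc n)) =
     {A. A \<subseteq> seqs (Suc (Suc n)) \<and>
         finite {i. {x \<in> seqs (Suc n). i # x \<in> A} \<notin> Fin_pow (Suc n)}}"

text \<open>A family \<open>X\<close> assigns a set of naturals to every finite sequence; only its values on nonempty
  sequences matter. \<open>Fin_part X n\<close> is $\mathrm{Fin}^{n+2}(\{X_s : s \in \omega^{n+1}\})$.\<close>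

definition Fin_part :: "(nat list \<Rightarrow> nat set) \<Rightarrow> nat \<Rightarrow> nat set set" where
  "Fin_part X n = {A. {s \<in> seqs (n + 1). infinite (A \<inter> X s)} \<in> Fin_pow (n + 1)}"

definition Fin_omega' :: "(nat list \<Rightarrow> nat set) \<Rightarrow> nat set set" where
  "Fin_omega' X = {A. \<exists>\<F>. finite \<F> \<and> \<F> \<subseteq> (\<Union>n. Fin_part X n) \<and> A \<subseteq> \<Union>\<F>}"

text \<open>The relations $\mathcal{I} \sqsubseteq \mathcal{J}$ and $\mathcal{I} \le_K \mathcal{J}$, each
  ideal being preceded by its domain. The witness maps $\mathrm{dom}(\mathcal{J})$ to
  $\mathrm{dom}(\mathcal{I})$.\<close>

definition bij_below :: "'a set \<Rightarrow> 'a set set \<Rightarrow> 'b set \<Rightarrow> 'b set set \<Rightarrow> bool" where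
  "bij_below D I E J \<longleftrightarrow> (\<exists>f. bij_betw f E D \<and> (\<forall>A\<in>I. f -` A \<inter> E \<in> J))"

definition katetov_below :: "'a set \<Rightarrow> 'a set set \<Rightarrow> 'b set \<Rightarrow> 'b set set \<Rightarrow> bool" where
  "katetov_below D I E J \<longleftrightarrow> (\<exists>f. f \<in> E \<rightarrow> D \<and> (\<forall>A\<in>I. f -` A \<inter> E \<in> J))"

end

theory Submission
  imports Defs
begin

text \<open>Splitting off the last coordinate instead of the first exhibits \<open>Fin\<^sup>n\<^sup>+\<^sup>2\<close> as the Fubini
  product \<open>Fin\<^sup>n\<^sup>+\<^sup>1 \<otimes> Fin\<close>. A map \<open>h\<close> from \<open>D\<close> to \<open>\<omega>\<^sup>n\<^sup>+\<^sup>2\<close> witnessing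
  \<open>Fin\<^sup>n\<^sup>+\<^sup>2 \<le>\<^sub>K I\<close> therefore gives a map \<open>butlast \<circ> h\<close> to \<open>\<omega>\<^sup>n\<^sup>+\<^sup>1\<close> that
  witnesses \<open>Fin\<^sup>n\<^sup>+\<^sup>1 \<le>\<^sub>K I\<close> and, in addition, every set on which it is finite-to-one lies
  in \<open>I\<close>. Given such maps \<open>h\<^sub>n\<close> for all \<open>n\<close>, send the \<open>k\<close>-th element \<open>x\<close> of \<open>D\<close> injectively into
  the intersection of the sets \<open>X (butlast (h\<^sub>i x))\<close> for \<open>i \<le> k\<close>. Off finitely many points, the
  preimage of a set \<open>A\<close> of \<open>Fin_part X n\<close> splits into points whose block meets \<open>A\<close> in an infinite
  set, and points on which \<open>butlast \<circ> h\<^sub>n\<close> is finite-to-one; both parts are in \<open>I\<close>.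
  Redefining this injection on an infinite member of \<open>I\<close> makes it a bijection. Conversely,
  labelling the points of each block \<open>X s\<close> by \<open>s @ [0], s @ [1], \<dots>\<close> shows that \<open>Fin\<^sup>n\<^sup>+\<^sup>2\<close> lies
  below the ideal generated by the \<open>Fin_part X n\<close>.\<close>

section \<open>Closure properties of ideals and of the two orders\<close>

lemma ideal_on_subset: "ideal_on D I \<Longrightarrow> A \<in> I \<Longrightarrow> B \<subseteq> A \<Longrightarrow> B \<in> I"
  unfolding ideal_on_def by blast

lemma ideal_on_Un: "ideal_on D I \<Longrightarrow> A \<in> I \<Longrightarrow> B \<in> I \<Longrightarrow> A \<union> B \<in> I"
  unfolding ideal_on_def by blast

lemma ideal_on_finite: "ideal_on D I \<Longrightarrow> A \<subseteq> D \<Longrightarrow> finite A \<Longrightarrow> A \<in> I"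
  unfolding ideal_on_def by blast

lemma ideal_on_Union:
  assumes "ideal_on D I" "finite \<F>" "\<And>A. A \<in> \<F> \<Longrightarrow> A \<in> I"
  shows "\<Union>\<F> \<in> I"
  using assms(2,3)
  by (induction \<F>) (auto intro: ideal_on_Un[OF assms(1)] ideal_on_finite[OF assms(1)])

lemma bij_below_imp_katetov_below:
  "bij_below D I E J \<Longrightarrow> katetov_below D I E J"
  unfolding bij_below_def katetov_below_def using bij_betw_imp_funcset by blast

lemma katetov_below_trans:
  assumes "katetov_below D I E J" "katetov_below E J F K"
  shows "katetov_below D I F K"
proof -
  obtain f g where f: "f \<in> E \<rightarrow> D" "\<forall>A\<in>I. f -` A \<inter> E \<in> J"
    and g: "g \<in> F \<rightarrow> E" "\<forall>A\<in>J. g -` A \<inter> F \<in> K"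
    using assms unfolding katetov_below_def by blast
  have "(f \<circ> g) -` A \<inter> F = g -` (f -` A \<inter> E) \<inter> F" for A
    using g(1) by auto
  then have "\<forall>A\<in>I. (f \<circ> g) -` A \<inter> F \<in> K"
    using f(2) g(2) by metis
  moreover have "f \<circ> g \<in> F \<rightarrow> D"
    using f(1) g(1) by auto
  ultimately show ?thesis
    unfolding katetov_below_def by blast
qed

lemma bij_below_trans:
  assumes "bij_below D I E J" "bij_below E J F K"
  shows "bij_below D I F K"
proof -
  obtain f g where f: "bij_betw f E D" "\<forall>A\<in>I. f -` A \<inter> E \<in> J"
    and g: "bij_betw g F E" "\<forall>A\<in>J. g -` A \<inter> F \<in> K"
    using assms unfolding bij_below_def by blast
  have "(f \<circ> g) -` A \<inter> F = g -` (f -` A \<inter> E) \<inter> F" for A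
    using bij_betw_imp_funcset[OF g(1)] by auto
  then have "\<forall>A\<in>I. (f \<circ> g) -` A \<inter> F \<in> K"
    using f(2) g(2) by metis
  moreover have "bij_betw (f \<circ> g) F D"
    using f(1) g(1) by (metis bij_betw_trans)
  ultimately show ?thesis
    unfolding bij_below_def by blast
qed

section \<open>The powers of Fin seen from the last coordinate\<close>

lemma seqs_Suc_snoc: "t \<in> seqs (Suc n) \<longleftrightarrow> (\<exists>s k. s \<in> seqs n \<and> t = s @ [k])"
  by (cases t rule: rev_cases) (auto simp: seqs_def)

lemma seqs_1: "seqs (Suc 0) = range (\<lambda>i. [i])"
  by (auto simp: seqs_def length_Suc_conv)

lemma Fin_pow_subset: "A \<in> Fin_pow (Suc n) \<Longrightarrow> A \<subseteq> seqs (Suc n)"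
  by (cases n) auto

lemma empty_in_Fin_pow: "{} \<in> Fin_pow (Suc n)"
  by (induction n) auto

text \<open>Induction on \<open>n\<close>: taking the section at a first coordinate \<open>i\<close>
  commutes with collecting the \<open>s\<close> that have infinitely many extensions
  \<open>s @ [k]\<close>, so the induction hypothesis applies to each section of
  \<open>A\<close>.\<close>

lemma Fin_pow_snoc_iff:
  assumes "A \<subseteq> seqs (Suc (Suc n))"
  shows "A \<in> Fin_pow (Suc (Suc n)) \<longleftrightarrow>
    {s \<in> seqs (Suc n). infinite {k. s @ [k] \<in> A}} \<in> Fin_pow (Suc n)"
  using assms
proof (induction n arbitrary: A)
  case 0
  have "{x \<in> seqs (Suc 0). i # x \<in> A} = (\<lambda>k. [k]) ` {k. [i, k] \<in> A}" for i
    by (auto simp: seqs_1)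
  then have 1: "{i. {x \<in> seqs (Suc 0). i # x \<in> A} \<notin> Fin_pow (Suc 0)} = {i. infinite {k. [i, k] \<in> A}}"
    by (auto simp: finite_image_iff inj_on_def seqs_1)
  have 2: "{s \<in> seqs (Suc 0). infinite {k. s @ [k] \<in> A}} = (\<lambda>i. [i]) ` {i. infinite {k. [i, k] \<in> A}}"
    by (auto simp: seqs_1)
  show ?case
    using 0 1 unfolding 2 by (auto simp: finite_image_iff inj_on_def seqs_1)
next
  case (Suc n)
  let ?S = "{s \<in> seqs (Suc (Suc n)). infinite {k. s @ [k] \<in> A}}"
  have "{x \<in> seqs (Suc (Suc n)). i # x \<in> A} \<in> Fin_pow (Suc (Suc n)) \<longleftrightarrow>
      {s \<in> seqs (Suc n). i # s \<in> ?S} \<in> Fin_pow (Suc n)" for i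
  proof -
    have "{s \<in> seqs (Suc n). infinite {k. s @ [k] \<in> {x \<in> seqs (Suc (Suc n)). i # x \<in> A}}} =
        {s \<in> seqs (Suc n). i # s \<in> ?S}"
      by (auto simp: seqs_def)
    then show ?thesis
      using Suc.IH[of "{x \<in> seqs (Suc (Suc n)). i # x \<in> A}"] by auto
  qed
  moreover have "?S \<subseteq> seqs (Suc (Suc n))" by blast
  ultimately show ?case
    using Suc.prems by (subst (1 2) Fin_pow.simps(3)) simp
qed

section \<open>Injective choices and their repair to bijections\<close>

lemma injective_choice_nat:
  fixes Y :: "nat \<Rightarrow> nat set"
  assumes "\<And>n. infinite (Y n)"
  shows "\<exists>g. inj g \<and> (\<forall>n. g n \<in> Y n)"
proof -
  have "\<exists>g. \<forall>n. g n \<in> Y n \<and> g n < g (Suc n)"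
  proof (rule dependent_nat_choice)
    show "\<exists>x. x \<in> Y 0"
      using assms[of 0] by (metis finite.emptyI ex_in_conv)
    show "\<exists>y. y \<in> Y (Suc n) \<and> x < y" for x n
      using assms[of "Suc n"] by (auto simp: infinite_nat_iff_unbounded)
  qed
  then show ?thesis
    using strict_mono_imp_inj_on strict_mono_Suc_iff by blast
qed

text \<open>If all members of \<open>I\<close> were finite, the fibres of \<open>p\<close> would be
  finite, so \<open>p\<close> would be finite-to-one on all of \<open>D\<close> and \<open>D\<close>
  itself would lie in \<open>I\<close>.\<close>

lemma infinite_member_of_ideal:
  assumes ideal: "ideal_on D I"
    and finite_to_one: "\<And>B. B \<subseteq> D \<Longrightarrow> (\<And>s. finite {x \<in> B. p x = s}) \<Longrightarrow> B \<in> I"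
    and fibre: "\<And>s. {x \<in> D. p x = s} \<in> I"
  shows "\<exists>C\<in>I. infinite C"
proof (rule ccontr)
  assume "\<not> ?thesis"
  then have "finite {x \<in> D. p x = s}" for s
    using fibre by blast
  then have "D \<in> I"
    by (intro finite_to_one) auto
  then show False
    using ideal by (simp add: ideal_on_def)
qed

lemma extend_to_bijection:
  fixes f :: "'a \<Rightarrow> nat"
  assumes "countable D" "inj_on f D" "C \<subseteq> D" "infinite C"
  shows "\<exists>g. bij_betw g D UNIV \<and> (\<forall>x\<in>D - C. g x = f x)"
proof -
  have "f ` C \<subseteq> - f ` (D - C)"
    using assms(2,3) by (fastforce dest: inj_onD)
  then have "infinite (- f ` (D - C))"
    using assms by (meson finite_imageD finite_subset inj_on_subset)
  then have "bij_betw (from_nat_into (- f ` (D - C))) UNIV (- f ` (D - C))"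
    by (simp add: bij_betw_from_nat_into)
  moreover have "bij_betw (to_nat_on C) C UNIV"
    using assms by (meson countable_subset to_nat_on_infinite)
  ultimately obtain u where u: "bij_betw u C (- f ` (D - C))"
    using bij_betw_trans by blast
  define g where "g x = (if x \<in> C then u x else f x)" for x
  have "bij_betw g C (- f ` (D - C))"
    using u by (simp add: g_def cong: bij_betw_cong)
  moreover have "bij_betw g (D - C) (f ` (D - C))"
  proof -
    have "bij_betw f (D - C) (f ` (D - C))"
      using assms(2) by (meson Diff_subset inj_on_imp_bij_betw inj_on_subset)
    then show ?thesis
      by (subst bij_betw_cong[where g = f]) (auto simp: g_def)
  qed
  ultimately have "bij_betw g (C \<union> (D - C)) (- f ` (D - C) \<union> f ` (D - C))"
    by (rule bij_betw_combine) auto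
  moreover have "C \<union> (D - C) = D" "- f ` (D - C) \<union> f ` (D - C) = UNIV"
    using assms(3) by auto
  ultimately show ?thesis
    by (intro exI[of _ g]) (auto simp: g_def)
qed

section \<open>Powers of Fin below the ideal of the partitions\<close>

lemma Fin_part_subset_Fin_omega': "Fin_part X n \<subseteq> Fin_omega' X"
proof
  fix A assume "A \<in> Fin_part X n"
  then show "A \<in> Fin_omega' X"
    unfolding Fin_omega'_def by (intro CollectI exI[of _ "{A}"]) auto
qed

lemma partition_index:
  assumes "(\<Union>s\<in>S. X s) = UNIV" "disjoint_family_on X S"
  obtains \<sigma> where "\<And>k. \<sigma> k \<in> S" "\<And>k s. s \<in> S \<Longrightarrow> k \<in> X s \<longleftrightarrow> \<sigma> k = s"
proof -
  have "\<forall>k. \<exists>s. s \<in> S \<and> k \<in> X s"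
    using assms(1) by blast
  then obtain \<sigma> where "\<And>k. \<sigma> k \<in> S" "\<And>k. k \<in> X (\<sigma> k)"
    by metis
  with assms(2) show ?thesis
    by (intro that[of \<sigma>]) (auto simp: disjoint_family_on_def disjoint_iff, metis)
qed

text \<open>Sending each point to the index of its block makes every preimage a union of whole
  blocks. As blocks are infinite, the indices of the blocks met infinitely often form
  \<open>A\<close> itself.\<close>

lemma katetov_below_Fin_pow_Fin_omega':
  assumes "(\<Union>s\<in>seqs (Suc n). X s) = UNIV" "disjoint_family_on X (seqs (Suc n))"
    and "\<And>s. s \<in> seqs (Suc n) \<Longrightarrow> infinite (X s)"
  shows "katetov_below (seqs (Suc n)) (Fin_pow (Suc n)) UNIV (Fin_omega' X)"
proof -
  obtain \<sigma> where \<sigma>: "\<And>k. \<sigma> k \<in> seqs (Suc n)"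
      "\<And>k s. s \<in> seqs (Suc n) \<Longrightarrow> k \<in> X s \<longleftrightarrow> \<sigma> k = s"
    using partition_index[OF assms(1,2)] by metis
  have "\<sigma> -` A \<in> Fin_part X n" if A: "A \<in> Fin_pow (Suc n)" for A
  proof -
    have "\<sigma> -` A \<inter> X s = (if s \<in> A then X s else {})" if "s \<in> seqs (Suc n)" for s
      using \<sigma>(2)[OF that] by auto
    then have "{s \<in> seqs (Suc n). infinite (\<sigma> -` A \<inter> X s)} = A"
      using assms(3) Fin_pow_subset[OF A] by (auto split: if_splits)
    then show ?thesis
      using A by (simp add: Fin_part_def)
  qed
  then show ?thesis
    unfolding katetov_below_def using \<sigma>(1) Fin_part_subset_Fin_omega'[of X n]
    by (intro exI[of _ \<sigma>]) auto
qed

text \<open>The label of a point is the index of its block followed by its position inside the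
  block. The block \<open>X s\<close> then corresponds to the extensions of \<open>s\<close> by one
  entry, and \<open>Fin_pow_snoc_iff\<close> turns membership in the power into the condition
  defining \<open>Fin_part X n\<close>.\<close>

lemma bij_below_Fin_pow_Fin_omega':
  assumes "(\<Union>s\<in>seqs (Suc n). X s) = UNIV" "disjoint_family_on X (seqs (Suc n))"
    and "\<And>s. s \<in> seqs (Suc n) \<Longrightarrow> infinite (X s)"
  shows "bij_below (seqs (Suc (Suc n))) (Fin_pow (Suc (Suc n))) UNIV (Fin_omega' X)"
proof -
  obtain \<sigma> where \<sigma>: "\<And>k. \<sigma> k \<in> seqs (Suc n)"
      "\<And>k s. s \<in> seqs (Suc n) \<Longrightarrow> k \<in> X s \<longleftrightarrow> \<sigma> k = s"
    using partition_index[OF assms(1,2)] by metis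
  define G where "G k = \<sigma> k @ [to_nat_on (X (\<sigma> k)) k]" for k
  have bij: "bij_betw (to_nat_on (X s)) (X s) UNIV" if "s \<in> seqs (Suc n)" for s
    using assms(3)[OF that] by (simp add: to_nat_on_infinite)
  have "inj G"
  proof (rule injI)
    fix k l assume "G k = G l"
    then have "\<sigma> k = \<sigma> l" "to_nat_on (X (\<sigma> k)) k = to_nat_on (X (\<sigma> k)) l"
      by (auto simp: G_def)
    moreover have "k \<in> X (\<sigma> k)" "l \<in> X (\<sigma> l)"
      using \<sigma> by auto
    ultimately show "k = l"
      using bij[OF \<sigma>(1)[of k]] by (metis bij_betw_imp_inj_on inj_onD)
  qed
  moreover have "range G = seqs (Suc (Suc n))"
  proof (intro subset_antisym subsetI)
    fix t assume "t \<in> seqs (Suc (Suc n))"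
    then obtain s m where s: "s \<in> seqs (Suc n)" "t = s @ [m]"
      by (auto simp: seqs_Suc_snoc[of _ "Suc n"])
    then obtain k where "k \<in> X s" "to_nat_on (X s) k = m"
      using bij[OF s(1)] by (metis UNIV_I bij_betw_imp_surj_on image_iff)
    then have "G k = t"
      using \<sigma>(2) s by (auto simp: G_def)
    then show "t \<in> range G" by blast
  next
    fix t assume "t \<in> range G"
    then show "t \<in> seqs (Suc (Suc n))"
      using \<sigma>(1) unfolding seqs_Suc_snoc[of t "Suc n"] G_def by auto
  qed
  ultimately have "bij_betw G UNIV (seqs (Suc (Suc n)))"
    by (simp add: bij_betw_def)
  moreover have "G -` A \<in> Fin_part X n" if A: "A \<in> Fin_pow (Suc (Suc n))" for A
  proof -
    have "infinite (G -` A \<inter> X s) \<longleftrightarrow> infinite {m. s @ [m] \<in> A}" if s: "s \<in> seqs (Suc n)" for s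
    proof -
      have "G -` A \<inter> X s = {k \<in> X s. s @ [to_nat_on (X s) k] \<in> A}"
        using \<sigma>(2)[OF s] by (auto simp: G_def)
      then have "bij_betw (to_nat_on (X s)) (G -` A \<inter> X s) {m. s @ [m] \<in> A}"
        using bij[OF s] by (fastforce simp: bij_betw_def intro: inj_on_subset)
      then show ?thesis
        using bij_betw_finite by blast
    qed
    then have "{s \<in> seqs (Suc n). infinite (G -` A \<inter> X s)} =
        {s \<in> seqs (Suc n). infinite {m. s @ [m] \<in> A}}"
      by blast
    then show ?thesis
      using A Fin_pow_snoc_iff[OF Fin_pow_subset[OF A]] by (simp add: Fin_part_def)
  qed
  ultimately show ?thesis
    unfolding bij_below_def using Fin_part_subset_Fin_omega'[of X n]
    by (intro exI[of _ G]) auto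
qed

section \<open>From the powers of Fin back to the ideal of the partitions\<close>

lemma bij_below_Fin_pow_1:
  assumes "ideal_on D I"
  shows "bij_below (seqs (Suc 0)) (Fin_pow (Suc 0)) D I"
proof -
  have "countable D" "infinite D"
    using assms unfolding ideal_on_def by auto
  then have "bij_betw (to_nat_on D) D UNIV"
    by (rule to_nat_on_infinite)
  moreover have "bij_betw (\<lambda>i. [i]) UNIV (seqs (Suc 0))"
    by (auto simp: bij_betw_def inj_on_def seqs_1)
  ultimately obtain f where f: "bij_betw f D (seqs (Suc 0))"
    using bij_betw_trans by blast
  have "f -` A \<inter> D \<in> I" if "A \<in> Fin_pow (Suc 0)" for A
    using that f by (intro ideal_on_finite[OF assms] finite_vimage_IntI)
      (auto simp: bij_betw_def)
  with f show ?thesis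
    unfolding bij_below_def by blast
qed

text \<open>Among the sequences whose \<open>butlast\<close> lies in \<open>S\<close>, exactly the
  elements of \<open>S\<close> have infinitely many extensions, so this set is in the next power. If
  \<open>butlast \<circ> h\<close> is finite-to-one on \<open>B\<close>, no sequence has infinitely
  many extensions in the image of \<open>B\<close>, so that image is in the next power too.\<close>

lemma butlast_Fin_pow_witness:
  assumes ideal: "ideal_on D I"
    and h: "h \<in> D \<rightarrow> seqs (Suc (Suc n))"
    and pre: "\<And>A. A \<in> Fin_pow (Suc (Suc n)) \<Longrightarrow> h -` A \<inter> D \<in> I"
  shows "\<And>x. x \<in> D \<Longrightarrow> butlast (h x) \<in> seqs (Suc n)"
    and "\<And>S. S \<in> Fin_pow (Suc n) \<Longrightarrow> {x \<in> D. butlast (h x) \<in> S} \<in> I"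
    and "\<And>B. B \<subseteq> D \<Longrightarrow> (\<And>s. finite {x \<in> B. butlast (h x) = s}) \<Longrightarrow> B \<in> I"
proof -
  show "butlast (h x) \<in> seqs (Suc n)" if "x \<in> D" for x
    using h that by (auto simp: seqs_def Pi_iff)
  show "{x \<in> D. butlast (h x) \<in> S} \<in> I" if S: "S \<in> Fin_pow (Suc n)" for S
  proof -
    let ?A = "{t \<in> seqs (Suc (Suc n)). butlast t \<in> S}"
    have "{s \<in> seqs (Suc n). infinite {k. s @ [k] \<in> ?A}} = S"
      using Fin_pow_subset[OF S] by (auto simp: seqs_def)
    then have "?A \<in> Fin_pow (Suc (Suc n))"
      using S Fin_pow_snoc_iff[of ?A n] by auto
    then show ?thesis
      using pre[of ?A] h by (auto elim!: ideal_on_subset[OF ideal])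
  qed
  show "B \<in> I" if B: "B \<subseteq> D" and fin: "\<And>s. finite {x \<in> B. butlast (h x) = s}" for B
  proof -
    have sub: "h ` B \<subseteq> seqs (Suc (Suc n))"
      using h B by auto
    have "finite {k. s @ [k] \<in> h ` B}" for s
    proof (rule finite_subset)
      show "{k. s @ [k] \<in> h ` B} \<subseteq> (\<lambda>x. last (h x)) ` {x \<in> B. butlast (h x) = s}"
      proof
        fix k assume "k \<in> {k. s @ [k] \<in> h ` B}"
        then obtain x where "x \<in> B" "h x = s @ [k]"
          by (metis (lifting) imageE mem_Collect_eq)
        then show "k \<in> (\<lambda>x. last (h x)) ` {x \<in> B. butlast (h x) = s}"
          by (intro image_eqI[of _ _ x]) auto
      qed
    qed (use fin in blast)
    then have "h ` B \<in> Fin_pow (Suc (Suc n))"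
      unfolding Fin_pow_snoc_iff[OF sub] by (simp add: empty_in_Fin_pow)
    then show ?thesis
      using pre[of "h ` B"] B by (auto elim!: ideal_on_subset[OF ideal])
  qed
qed

lemma bij_below_Fin_omega':
  fixes X :: "nat list \<Rightarrow> nat set" and D :: "'a set"
  assumes inter: "\<And>(F :: nat set) (s :: nat \<Rightarrow> nat list).
      finite F \<Longrightarrow> (\<And>i. i \<in> F \<Longrightarrow> s i \<in> seqs (i + 1)) \<Longrightarrow> infinite (\<Inter>i\<in>F. X (s i))"
    and ideal: "ideal_on D I"
    and below: "\<And>n. katetov_below (seqs (Suc (Suc n))) (Fin_pow (Suc (Suc n))) D I"
  shows "bij_below UNIV (Fin_omega' X) D I"
proof -
  have D: "countable D" "infinite D"
    using ideal unfolding ideal_on_def by auto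
  obtain h where h: "\<And>n. h n \<in> D \<rightarrow> seqs (Suc (Suc n))"
    and pre: "\<And>n A. A \<in> Fin_pow (Suc (Suc n)) \<Longrightarrow> h n -` A \<inter> D \<in> I"
    using below unfolding katetov_below_def by metis
  define p where "p n x = butlast (h n x)" for n x
  have witness: "x \<in> D \<Longrightarrow> p n x \<in> seqs (Suc n)"
    "S \<in> Fin_pow (Suc n) \<Longrightarrow> {x \<in> D. p n x \<in> S} \<in> I"
    "B \<subseteq> D \<Longrightarrow> (\<And>s. finite {x \<in> B. p n x = s}) \<Longrightarrow> B \<in> I" for n x S B
    unfolding p_def using butlast_Fin_pow_witness[OF ideal h[of n] pre[of _ n], simplified]
    by simp_all
  define e where "e = to_nat_on D"
  have e: "bij_betw e D UNIV"
    using D by (simp add: e_def to_nat_on_infinite)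
  \<comment> \<open>Stage \<open>k\<close> involves only the partitions up to index
    \<open>k\<close>, so the intersection is finite and \<open>inter\<close> applies.\<close>
  have "infinite (\<Inter>i\<in>{..k}. X (p i (from_nat_into D k)))" for k
    using witness(1) D(2) by (intro inter) (auto intro: from_nat_into)
  then obtain g where g: "inj g" "\<And>k. g k \<in> (\<Inter>i\<in>{..k}. X (p i (from_nat_into D k)))"
    using injective_choice_nat[of "\<lambda>k. \<Inter>i\<in>{..k}. X (p i (from_nat_into D k))"] by blast
  define f where "f = g \<circ> e"
  have inj_f: "inj_on f D"
    unfolding f_def using g(1) e by (auto intro: comp_inj_on inj_on_subset simp: bij_betw_def)
  \<comment> \<open>For fixed \<open>n\<close> this fails to cover only the finitely many points
    with \<open>e x < n\<close>, collected below in \<open>?E\<close>.\<close>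
  have f: "f x \<in> X (p n x)" if "x \<in> D" "n \<le> e x" for x n
    using g(2)[of "e x"] that D by (auto simp: f_def e_def)
  have part: "f -` A \<inter> D \<in> I" if A: "A \<in> Fin_part X n" for A n
  proof -
    let ?S = "{s \<in> seqs (Suc n). infinite (A \<inter> X s)}"
    let ?E = "{x \<in> D. e x < n}"
    let ?B = "{x \<in> D. n \<le> e x \<and> p n x \<notin> ?S \<and> f x \<in> A}"
    have "finite (e -` {..<n} \<inter> D)"
      using e by (intro finite_vimage_IntI) (auto simp: bij_betw_def)
    moreover have "?E = e -` {..<n} \<inter> D" by auto
    ultimately have "?E \<in> I"
      by (intro ideal_on_finite[OF ideal]) auto
    moreover have "{x \<in> D. p n x \<in> ?S} \<in> I"
      using A by (intro witness(2)) (simp add: Fin_part_def)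
    moreover have "?B \<in> I"
    proof (rule witness(3))
      fix s
      show "finite {x \<in> ?B. p n x = s}"
      proof (cases "s \<in> seqs (Suc n) \<and> finite (A \<inter> X s)")
        case True
        \<comment> \<open>Points of the fibre satisfy \<open>n \<le> e x\<close>, so
          \<open>f\<close> maps them into \<open>A \<inter> X s\<close>, which is finite here;
          \<open>f\<close> is injective.\<close>
        have "finite (f -` (A \<inter> X s) \<inter> D)"
          using True inj_f by (intro finite_vimage_IntI) auto
        then show ?thesis
          by (rule rev_finite_subset) (use f in auto)
      next
        case False
        then have "{x \<in> ?B. p n x = s} = {}"
          using witness(1) by auto
        then show ?thesis by (simp only: finite.emptyI)
      qed
    qed auto
    ultimately have "?E \<union> {x \<in> D. p n x \<in> ?S} \<union> ?B \<in> I"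
      by (intro ideal_on_Un[OF ideal])
    then show ?thesis
      by (rule ideal_on_subset[OF ideal]) auto
  qed
  have "\<exists>C\<in>I. infinite C"
  proof (rule infinite_member_of_ideal[OF ideal])
    show "B \<in> I" if "B \<subseteq> D" "\<And>s. finite {x \<in> B. p 0 x = s}" for B
      using that by (rule witness(3))
    show "{x \<in> D. p 0 x = s} \<in> I" for s
    proof -
      \<comment> \<open>The intersection is empty when \<open>s\<close> has the wrong length, and
        then the fibre over \<open>s\<close> is empty as well.\<close>
      have "{x \<in> D. p 0 x \<in> {s} \<inter> seqs (Suc 0)} \<in> I"
        by (rule witness(2)) simp
      then show ?thesis
        by (rule ideal_on_subset[OF ideal]) (use witness(1) in auto)
    qed
  qed
  moreover have "I \<subseteq> Pow D"
    using ideal by (simp add: ideal_on_def)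
  ultimately obtain C where C: "C \<in> I" "infinite C" "C \<subseteq> D"
    by blast
  then obtain F where F: "bij_betw F D UNIV" "\<forall>x\<in>D - C. F x = f x"
    using extend_to_bijection[OF D(1) inj_f] by blast
  have "F -` A \<inter> D \<in> I" if A: "A \<in> Fin_omega' X" for A
  proof -
    obtain \<F> where \<F>: "finite \<F>" "\<F> \<subseteq> (\<Union>n. Fin_part X n)" "A \<subseteq> \<Union>\<F>"
      using A unfolding Fin_omega'_def by blast
    have "(\<Union>A\<in>\<F>. f -` A \<inter> D) \<in> I"
      using \<F> part by (intro ideal_on_Union[OF ideal]) auto
    then have "(\<Union>A\<in>\<F>. f -` A \<inter> D) \<union> C \<in> I"
      using C(1) by (intro ideal_on_Un[OF ideal])
    \<comment> \<open>Only on \<open>C\<close> can \<open>F\<close> differ from \<open>f\<close>,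
      and \<open>C\<close> is in \<open>I\<close>, so it absorbs the change.\<close>
    moreover have "F -` A \<inter> D \<subseteq> (\<Union>A\<in>\<F>. f -` A \<inter> D) \<union> C"
    proof
      fix x assume x: "x \<in> F -` A \<inter> D"
      then obtain A' where "A' \<in> \<F>" "F x \<in> A'"
        using \<F>(3) by blast
      moreover have "F x = f x" if "x \<notin> C"
        using F(2) x that by (metis DiffI IntD2)
      ultimately show "x \<in> (\<Union>A\<in>\<F>. f -` A \<inter> D) \<union> C"
        using x by (cases "x \<in> C") auto
    qed
    ultimately show ?thesis
      by (rule ideal_on_subset[OF ideal])
  qed
  with F(1) show ?thesis
    unfolding bij_below_def by blast
qed

theorem theorem5p1:
  fixes X :: "nat list \<Rightarrow> nat set"
    and D :: "'a set" and I :: "'a set set"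
  assumes cover: "\<And>n. (\<Union>s\<in>seqs (n + 1). X s) = UNIV"
    and disj: "\<And>n. disjoint_family_on X (seqs (n + 1))"
    and inf: "\<And>n s. s \<in> seqs (n + 1) \<Longrightarrow> infinite (X s)"
    and inter: "\<And>(F :: nat set) (s :: nat \<Rightarrow> nat list).
      finite F \<Longrightarrow> (\<And>i. i \<in> F \<Longrightarrow> s i \<in> seqs (i + 1)) \<Longrightarrow> infinite (\<Inter>i\<in>F. X (s i))"
    and ideal: "ideal_on D I"
  shows "(bij_below UNIV (Fin_omega' X) D I \<longleftrightarrow> katetov_below UNIV (Fin_omega' X) D I) \<and>
    (katetov_below UNIV (Fin_omega' X) D I \<longleftrightarrow>
      (\<forall>n. bij_below (seqs (n + 1)) (Fin_pow (n + 1)) D I)) \<and>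
    ((\<forall>n. bij_below (seqs (n + 1)) (Fin_pow (n + 1)) D I) \<longleftrightarrow>
      (\<forall>n. katetov_below (seqs (n + 1)) (Fin_pow (n + 1)) D I))"
proof -
  let ?a = "bij_below UNIV (Fin_omega' X) D I"
  let ?b = "katetov_below UNIV (Fin_omega' X) D I"
  let ?c = "\<forall>n. bij_below (seqs (n + 1)) (Fin_pow (n + 1)) D I"
  let ?d = "\<forall>n. katetov_below (seqs (n + 1)) (Fin_pow (n + 1)) D I"
  \<comment> \<open>The implications proved are a to b to d to a, and a to c to d, which connect all
    four statements.\<close>
  have "?a \<Longrightarrow> ?b" and "?c \<Longrightarrow> ?d"
    by (auto intro: bij_below_imp_katetov_below)
  moreover have "?d" if ?b
    using katetov_below_trans[OF katetov_below_Fin_pow_Fin_omega' that] cover disj inf by simp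
  moreover have ?a if ?d
  proof (rule bij_below_Fin_omega'[OF inter ideal])
    show "katetov_below (seqs (Suc (Suc n))) (Fin_pow (Suc (Suc n))) D I" for n
      using that by (metis Suc_eq_plus1)
  qed
  moreover have "?c" if ?a
  proof
    fix n
    show "bij_below (seqs (n + 1)) (Fin_pow (n + 1)) D I"
    \<comment> \<open>Labelling the blocks of the partition with index \<open>m\<close> yields
      sequences of length \<open>m + 2\<close>, so length one is treated separately.\<close>
    proof (cases n)
      case 0
      then show ?thesis
        using bij_below_Fin_pow_1[OF ideal] by simp
    next
      case (Suc m)
      then show ?thesis
        using bij_below_trans[OF bij_below_Fin_pow_Fin_omega' that] cover disj inf by simp
    qed
  qed
  ultimately show ?thesis by blast
qed

end
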